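(* Let $A$ be a finite dimensional central simple algebra with $1$ over a field $F$ (that is, $A$ is a simple algebra, finite dimensional over $F$, with center $\mathcal{Z}(A)=F$). Let $\sigma$ and $\tau$ be non-zero $F$-algebra endomorphisms of $A$. Then any $F$-linear $(\sigma,\tau)$-derivation of $A$ is a $(\sigma,\tau)$-inner derivation of $A$.
   Context: For $F$-algebra endomorphisms $\sigma,\tau$ of an $F$-algebra $A$ (not necessarily distinct), an $F$-linear $(\sigma,\tau)$-derivation of $A$ is an $F$-linear map $\delta:A\to A$ satisfying $\delta(ab)=\delta(a)\tau(b)+\sigma(a)\delta(b)$ for all $a,b\in A$. It is a $(\sigma,\tau)$-inner derivation if there is $x\in A$ such that $\delta(a)=x\tau(a)-\sigma(a)x$ for all $a\in A$. *)

theory Defs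
  imports Complex_Main
begin

text \<open>Associative algebras with 1 over a field. The class \<open>ring_1\<close> includes \<open>0 \<noteq> 1\<close>, so
  they are nonzero.\<close>

locale unital_algebra = vector_space scale
  for scale :: "'f::field \<Rightarrow> 'a::ring_1 \<Rightarrow> 'a" +
  assumes scale_mult_left: "scale c (a * b) = scale c a * b"
    and scale_mult_right: "scale c (a * b) = a * scale c b"

definition two_sided_ideal :: "'a::ring_1 set \<Rightarrow> bool" where
  "two_sided_ideal I \<longleftrightarrow>
     0 \<in> I \<and> (\<forall>a\<in>I. \<forall>b\<in>I. a - b \<in> I) \<and> (\<forall>a\<in>I. \<forall>r. r * a \<in> I \<and> a * r \<in> I)"

definition center :: "'a::ring_1 set" where
  "center = {z. \<forall>a. z * a = a * z}"

text \<open>Every two-sided ideal is a subspace, because \<open>scale c a = scale c 1 * a\<close>; hence there is no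
  difference between simplicity as a ring and simplicity as an algebra. The equation
  \<open>center = F\<close> is read through the embedding \<open>c \<mapsto> scale c 1\<close>.\<close>

locale central_simple_algebra = unital_algebra scale
  for scale :: "'f::field \<Rightarrow> 'a::ring_1 \<Rightarrow> 'a" +
  assumes finite_dimensional: "\<exists>B. finite_dimensional_vector_space scale B"
    and simple: "two_sided_ideal (I :: 'a set) \<Longrightarrow> I = {0} \<or> I = UNIV"
    and central: "(center :: 'a set) = range (\<lambda>c. scale c 1)"

context unital_algebra
begin

text \<open>Endomorphisms are not required to preserve 1; in particular the zero map is one.\<close>

definition algebra_endomorphism :: "('a \<Rightarrow> 'a) \<Rightarrow> bool" where
  "algebra_endomorphism \<sigma> \<longleftrightarrow>
     Vector_Spaces.linear scale scale \<sigma> \<and> (\<forall>a b. \<sigma> (a * b) = \<sigma> a * \<sigma> b)"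

definition twisted_derivation :: "('a \<Rightarrow> 'a) \<Rightarrow> ('a \<Rightarrow> 'a) \<Rightarrow> ('a \<Rightarrow> 'a) \<Rightarrow> bool" where
  "twisted_derivation \<sigma> \<tau> \<delta> \<longleftrightarrow>
     Vector_Spaces.linear scale scale \<delta> \<and> (\<forall>a b. \<delta> (a * b) = \<delta> a * \<tau> b + \<sigma> a * \<delta> b)"

definition twisted_inner_derivation :: "('a \<Rightarrow> 'a) \<Rightarrow> ('a \<Rightarrow> 'a) \<Rightarrow> ('a \<Rightarrow> 'a) \<Rightarrow> bool" where
  "twisted_inner_derivation \<sigma> \<tau> \<delta> \<longleftrightarrow>
     twisted_derivation \<sigma> \<tau> \<delta> \<and> (\<exists>x. \<forall>a. \<delta> a = x * \<tau> a - \<sigma> a * x)"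

end

end

theory Submission
  imports Defs
begin

text \<open>
  The kernel of \<open>\<tau>\<close> is a proper ideal, so \<open>\<tau>\<close> is injective, hence bijective, and \<open>\<tau> 1 = 1\<close>.
  Central simplicity gives, by the Artin--Whaples density argument, a map \<open>f\<close>,
  \<open>y \<mapsto> \<Sum>e\<in>B. w e * y * e\<close> (\<open>B\<close> a basis) with central values that fixes \<open>1\<close>. Comparing
  coefficients in \<open>x * f y = f y * x\<close> shows that \<open>\<Sum>e\<in>B. w e \<otimes> e\<close> is a separability idempotent of \<open>A\<close>,
  and then \<open>\<Sum>e\<in>B. \<delta> (w e) * \<tau> e\<close> implements \<open>\<delta>\<close>.
\<close>

section \<open>Multiplication maps and two-sided ideals\<close>

text \<open>These are the maps \<open>y \<mapsto> \<Sum>i. u i * y * v i\<close>, the image of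
  \<open>A \<otimes> A^op\<close> in the linear endomorphisms of \<open>A\<close>. Generating them
  inductively gives inductions that need no chosen presentation as a sum.\<close>

inductive multiplication_map :: "('a::ring_1 \<Rightarrow> 'a) \<Rightarrow> bool" where
  ident: "multiplication_map (\<lambda>y. y)"
| left: "multiplication_map T \<Longrightarrow> multiplication_map (\<lambda>y. u * T y)"
| right: "multiplication_map T \<Longrightarrow> multiplication_map (\<lambda>y. T y * v)"
| add: "multiplication_map S \<Longrightarrow> multiplication_map T \<Longrightarrow> multiplication_map (\<lambda>y. S y + T y)"

lemma multiplication_map_diff:
  assumes "multiplication_map S" "multiplication_map T"
  shows "multiplication_map (\<lambda>y. S y - T y)"
  using multiplication_map.add[OF assms(1) multiplication_map.left[OF assms(2), of "-1"]] by simp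

lemma multiplication_map_zero: "multiplication_map (\<lambda>_. 0)"
  using multiplication_map.left[OF multiplication_map.ident, of 0] by simp

text \<open>The orbit is the ideal generated by \<open>b\<close>; this is how simplicity of the
  algebra enters the density argument.\<close>

lemma two_sided_ideal_multiplication_orbit:
  "two_sided_ideal {T b |T. multiplication_map T}"
  unfolding two_sided_ideal_def
proof (intro conjI ballI allI)
  show "0 \<in> {T b |T. multiplication_map T}"
    using multiplication_map_zero by force
next
  fix x y assume "x \<in> {T b |T. multiplication_map T}" "y \<in> {T b |T. multiplication_map T}"
  then obtain S T where "multiplication_map S" "multiplication_map T" "x = S b" "y = T b"
    by blast
  then show "x - y \<in> {T b |T. multiplication_map T}"
    using multiplication_map_diff[of S T] by (intro CollectI exI[of _ "\<lambda>y. S y - T y"]) simp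
next
  fix x r assume "x \<in> {T b |T. multiplication_map T}"
  then obtain T where T: "multiplication_map T" "x = T b"
    by blast
  show "r * x \<in> {T b |T. multiplication_map T}"
    using multiplication_map.left[OF T(1), of r] T(2) by (intro CollectI exI[of _ "\<lambda>y. r * T y"]) simp
  show "x * r \<in> {T b |T. multiplication_map T}"
    using multiplication_map.right[OF T(1), of r] T(2) by (intro CollectI exI[of _ "\<lambda>y. T y * r"]) simp
qed

lemma (in vector_space) sum_representation_basis:
  assumes "independent B" "span B = UNIV" "finite B"
  shows "(\<Sum>e\<in>B. scale (representation B v e) e) = v"
  using sum_representation_eq[OF assms(1) _ assms(3) subset_refl, of v] assms(2) by simp

context unital_algebra
begin

lemma linear_multiplication_map:
  "multiplication_map T \<Longrightarrow> Vector_Spaces.linear scale scale T"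
proof (induction rule: multiplication_map.induct)
  case ident
  show ?case by (rule linear_ident)
next
  case (left T u)
  then interpret T: Vector_Spaces.linear scale scale T by simp
  show ?case
    by unfold_locales (simp_all add: T.add T.scale distrib_left scale_mult_right)
next
  case (right T v)
  then interpret T: Vector_Spaces.linear scale scale T by simp
  show ?case
    by unfold_locales (simp_all add: T.add T.scale distrib_right scale_mult_left)
next
  case (add S T)
  then interpret S: Vector_Spaces.linear scale scale S by simp
  interpret T: Vector_Spaces.linear scale scale T by (rule add.IH(2))
  show ?case
    by unfold_locales (simp_all add: S.add S.scale T.add T.scale scale_right_distrib)
qed

end

section \<open>Density of the multiplication maps\<close>

context central_simple_algebra
begin

lemma multiplication_map_to_one:
  fixes b :: 'a
  assumes "b \<noteq> 0"
  obtains T where "multiplication_map T" "T b = 1"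
proof -
  have "b \<in> {T b |T. multiplication_map T}"
    using multiplication_map.ident by force
  then have "{T b |T. multiplication_map T} = UNIV"
    using simple[OF two_sided_ideal_multiplication_orbit[of b]] assms by blast
  then have "1 \<in> {T b |T. multiplication_map T}"
    by simp
  then show ?thesis
    using that by (smt (verit) mem_Collect_eq)
qed

text \<open>Artin--Whaples density, by induction on \<open>C\<close>. Once some map kills the
  enlarged set but not \<open>b\<close>, simplicity brings its value at \<open>b\<close> to
  \<open>1\<close>. If there were no such map, centrality would force a linear dependence.\<close>

lemma multiplication_map_separates:
  assumes "finite C" "b \<notin> span C"
  shows "\<exists>T. multiplication_map T \<and> T b = 1 \<and> (\<forall>c\<in>C. T c = 0)"
  using assms
proof (induction C arbitrary: b rule: finite_induct)
  case empty
  then show ?case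
    using multiplication_map_to_one[of b] by auto
next
  case (insert c C)
  have b: "b \<notin> span C"
    using insert.prems span_mono[of C "insert c C"] by blast
  show ?case
  proof (cases "c \<in> span C")
    case True
    obtain T where T: "multiplication_map T" "T b = 1" "\<forall>c\<in>C. T c = 0"
      using insert.IH[OF b] by blast
    interpret T: Vector_Spaces.linear scale scale T
      by (rule linear_multiplication_map[OF T(1)])
    have "T c = 0"
      by (rule T.eq_0_on_span[OF _ True]) (use T(3) in blast)
    with T show ?thesis by blast
  next
    case False
    obtain S where S: "multiplication_map S" "S c = 1" "\<forall>c\<in>C. S c = 0"
      using insert.IH[OF False] by blast
    have "\<exists>U. multiplication_map U \<and> U b \<noteq> 0 \<and> (\<forall>c\<in>insert c C. U c = 0)"
    proof (rule ccontr)
      assume "\<not> ?thesis"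
      then have vanish: "U b = 0" if "multiplication_map U" "\<forall>c\<in>insert c C. U c = 0" for U
        using that by blast
      \<comment> \<open>The map \<open>y \<mapsto> S y * x - x * S y\<close> kills \<open>C\<close>,
        and it kills \<open>c\<close> because \<open>S c = 1\<close> commutes with \<open>x\<close>.
        Hence it kills \<open>b\<close>.\<close>
      have "S b * x = x * S b" for x
        using vanish[OF multiplication_map_diff[OF multiplication_map.right[OF S(1), of x]
              multiplication_map.left[OF S(1), of x]]] S by simp
      then have "S b \<in> center"
        by (simp add: center_def)
      then obtain k where k: "S b = scale k 1"
        using central by auto
      have "b - scale k c \<notin> span C"
        using insert.prems span_breakdown_eq by blast
      then obtain T where T: "multiplication_map T" "T (b - scale k c) = 1" "\<forall>c\<in>C. T c = 0"
        using insert.IH by blast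
      interpret T: Vector_Spaces.linear scale scale T
        by (rule linear_multiplication_map[OF T(1)])
      \<comment> \<open>The map \<open>y \<mapsto> T y - T c * S y\<close> kills \<open>C\<close>,
        and \<open>c\<close> because \<open>S c = 1\<close>. Since \<open>S b\<close> is the scalar
        \<open>k\<close>, its value at \<open>b\<close> is \<open>T (b - scale k c)\<close>, which
        was chosen to be \<open>1\<close>.\<close>
      have "T b - T c * S b = 0"
        using vanish[OF multiplication_map_diff[OF T(1) multiplication_map.left[OF S(1), of "T c"]]]
          S T(3) by simp
      then have "T (b - scale k c) = 0"
        by (simp add: T.diff T.scale k flip: scale_mult_right)
      with T(2) show False by simp
    qed
    then obtain U where U: "multiplication_map U" "U b \<noteq> 0" "\<forall>c\<in>insert c C. U c = 0"
      by blast
    obtain V where V: "multiplication_map V" "V (U b) = 1"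
      using multiplication_map_to_one[OF U(2)] .
    interpret V: Vector_Spaces.linear scale scale V
      by (rule linear_multiplication_map[OF V(1)])
    have "multiplication_map (\<lambda>y. V (U y))"
      using V(1)
      by (induction rule: multiplication_map.induct) (auto intro: U(1) multiplication_map.intros)
    then show ?thesis
      using U(3) V(2) V.zero by (intro exI[of _ "\<lambda>y. V (U y)"]) simp
  qed
qed

section \<open>Coordinates of multiplication maps\<close>

text \<open>Right factors are expanded in the basis and their scalar coordinates are moved into the
  left coefficients.\<close>

lemma multiplication_map_basis_expansion:
  assumes "multiplication_map T" and B: "independent B" "span B = UNIV" "finite B"
  obtains w where "\<And>y. T y = (\<Sum>e\<in>B. w e * y * e)"
proof -
  have expand: "(\<Sum>e\<in>B. scale (representation B v e) e) = v" for v
    by (rule sum_representation_basis[OF B])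
  have "\<exists>w. \<forall>y. T y = (\<Sum>e\<in>B. w e * y * e)"
    using assms(1)
  proof (induction rule: multiplication_map.induct)
    case ident
    have "y = (\<Sum>e\<in>B. scale (representation B 1 e) 1 * y * e)" for y
    proof -
      have "y = y * (\<Sum>e\<in>B. scale (representation B 1 e) e)"
        by (simp add: expand)
      also have "\<dots> = (\<Sum>e\<in>B. scale (representation B 1 e) 1 * y * e)"
        by (simp add: sum_distrib_left flip: scale_mult_left scale_mult_right)
      finally show ?thesis .
    qed
    then show ?case by (intro exI[of _ "\<lambda>e. scale (representation B 1 e) 1"]) blast
  next
    case (left T u)
    then obtain w where "\<forall>y. T y = (\<Sum>e\<in>B. w e * y * e)" by blast
    then show ?case
      by (intro exI[of _ "\<lambda>e. u * w e"]) (simp add: sum_distrib_left mult.assoc)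
  next
    case (right T v)
    then obtain w where w: "\<forall>y. T y = (\<Sum>e\<in>B. w e * y * e)" by blast
    have "T y * v = (\<Sum>j\<in>B. (\<Sum>e\<in>B. scale (representation B (e * v) j) (w e)) * y * j)" for y
    proof -
      have "T y * v = (\<Sum>e\<in>B. w e * y * (\<Sum>j\<in>B. scale (representation B (e * v) j) j))"
        using w by (simp add: expand sum_distrib_right mult.assoc)
      also have "\<dots> = (\<Sum>e\<in>B. \<Sum>j\<in>B. scale (representation B (e * v) j) (w e) * y * j)"
        by (simp add: sum_distrib_left flip: scale_mult_left scale_mult_right)
      also have "\<dots> = (\<Sum>j\<in>B. \<Sum>e\<in>B. scale (representation B (e * v) j) (w e) * y * j)"
        by (rule sum.swap)
      finally show ?thesis
        by (simp add: sum_distrib_right)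
    qed
    then show ?case
      by (intro exI[of _ "\<lambda>j. \<Sum>e\<in>B. scale (representation B (e * v) j) (w e)"]) blast
  next
    case (add S T)
    then obtain w w' where "\<forall>y. S y = (\<Sum>e\<in>B. w e * y * e)" "\<forall>y. T y = (\<Sum>e\<in>B. w' e * y * e)"
      by blast
    then show ?case
      by (intro exI[of _ "\<lambda>e. w e + w' e"]) (simp add: sum.distrib distrib_right)
  qed
  then show ?thesis
    using that by blast
qed

text \<open>This is injectivity of \<open>A \<otimes> A^op \<rightarrow> End A\<close>, in
  coordinates. A map \<open>T\<close> separating \<open>b\<close> from the other basis elements can
  be applied to the right factors without destroying the vanishing of the sum.\<close>

lemma multiplication_coefficients_zero:
  assumes B: "independent B" "finite B"
    and zero: "\<And>y. (\<Sum>e\<in>B. w e * y * e) = 0" and "b \<in> B"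
  shows "w b = 0"
proof -
  have "b \<notin> span (B - {b})"
    using B(1) \<open>b \<in> B\<close> by (auto simp: dependent_def)
  then obtain T where T: "multiplication_map T" "T b = 1" "\<forall>c\<in>B - {b}. T c = 0"
    using multiplication_map_separates[of "B - {b}" b] B(2) by auto
  \<comment> \<open>The induction keeps \<open>y\<close> arbitrary: a left factor \<open>u\<close>
    of \<open>T\<close> is absorbed by passing from \<open>y\<close> to
    \<open>y * u\<close>.\<close>
  have "(\<Sum>e\<in>B. w e * y * T e) = 0" for y
    using T(1)
  proof (induction arbitrary: y rule: multiplication_map.induct)
    case ident
    show ?case by (rule zero)
  next
    case (left T u)
    show ?case using left.IH[of "y * u"] by (simp add: mult.assoc)
  next
    case (right T v)
    show ?case using arg_cong[OF right.IH[of y], of "\<lambda>s. s * v"]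
      by (simp add: sum_distrib_right mult.assoc)
  next
    case (add S T)
    show ?case using add.IH[of y] by (simp add: distrib_left sum.distrib)
  qed
  from this[of 1] show ?thesis
    using T B(2) \<open>b \<in> B\<close> by (simp add: sum.remove[of B b])
qed

section \<open>The separability idempotent\<close>

text \<open>The last conclusion says that \<open>\<Sum>e\<in>B. w e \<otimes> e\<close> commutes with \<open>x\<close>, in coordinates.\<close>

lemma separability_idempotent:
  obtains B w where "independent B" "span B = UNIV" "finite B" "(\<Sum>e\<in>B. w e * e) = 1"
    "\<And>x j. j \<in> B \<Longrightarrow> x * w j = (\<Sum>e\<in>B. scale (representation B (e * x) j) (w e))"
proof -
  obtain B0 where "finite_dimensional_vector_space scale B0"
    using finite_dimensional by blast
  then interpret fd: finite_dimensional_vector_space scale B0 .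
  \<comment> \<open>With \<open>1\<close> in the basis, density yields a \<open>T\<close> that fixes
    \<open>1\<close> and kills the other basis elements, so all its values are scalars.\<close>
  define B where "B = extend_basis {1::'a}"
  have one: "independent {1::'a}"
    by simp
  have B: "independent B" "span B = UNIV" "1 \<in> B"
    using independent_extend_basis[OF one] span_extend_basis[OF one] extend_basis_superset[OF one]
    by (auto simp: B_def)
  have finB: "finite B"
    by (rule fd.finiteI_independent[OF B(1)])
  have "1 \<notin> span (B - {1})"
    using B by (auto simp: dependent_def)
  then obtain T where T: "multiplication_map T" "T 1 = 1" "\<forall>c\<in>B - {1}. T c = 0"
    using multiplication_map_separates[of "B - {1}" 1] finB by auto
  interpret T: Vector_Spaces.linear scale scale T
    by (rule linear_multiplication_map[OF T(1)])
  have "T y \<in> span {1}" for y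
  proof -
    have "y \<in> span B" by (simp add: B(2))
    then have "T y \<in> span (T ` B)"
      by (simp add: T.span_image)
    moreover have "T ` B \<subseteq> span {1}"
      using T(2,3) span_base[of 1 "{1}"] span_zero[of "{1}"]
      by (metis Diff_iff image_subsetI insertI1 singletonD)
    ultimately show ?thesis
      using span_minimal[OF _ subspace_span] by blast
  qed
  then have comm: "T y * x = x * T y" for x y
    using central by (auto simp: span_singleton center_def)
  obtain w where w: "\<And>y. T y = (\<Sum>e\<in>B. w e * y * e)"
    using multiplication_map_basis_expansion[OF T(1) B(1,2) finB] by blast
  have expand: "(\<Sum>j\<in>B. scale (representation B v j) j) = v" for v
    by (rule sum_representation_basis[OF B(1,2) finB])
  \<comment> \<open>Both \<open>x * T y\<close> and \<open>T y * x\<close> are expanded with right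
    factors in \<open>B\<close>; they agree for all \<open>y\<close>, so their left coefficients
    agree.\<close>
  have "x * w j - (\<Sum>e\<in>B. scale (representation B (e * x) j) (w e)) = 0" if "j \<in> B" for x j
  proof (rule multiplication_coefficients_zero[OF B(1) finB _ that])
    fix y
    have "T y * x = (\<Sum>e\<in>B. w e * y * (\<Sum>j\<in>B. scale (representation B (e * x) j) j))"
      by (simp add: w expand sum_distrib_right mult.assoc)
    also have "\<dots> = (\<Sum>e\<in>B. \<Sum>j\<in>B. scale (representation B (e * x) j) (w e) * y * j)"
      by (simp add: sum_distrib_left flip: scale_mult_left scale_mult_right)
    also have "\<dots> = (\<Sum>j\<in>B. \<Sum>e\<in>B. scale (representation B (e * x) j) (w e) * y * j)"
      by (rule sum.swap)
    finally have "T y * x = (\<Sum>j\<in>B. (\<Sum>e\<in>B. scale (representation B (e * x) j) (w e)) * y * j)"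
      by (simp add: sum_distrib_right)
    moreover have "x * T y = (\<Sum>j\<in>B. x * w j * y * j)"
      by (simp add: w sum_distrib_left mult.assoc)
    ultimately show "(\<Sum>j\<in>B. (x * w j - (\<Sum>e\<in>B. scale (representation B (e * x) j) (w e))) * y * j) = 0"
      using comm[of y x] by (simp add: left_diff_distrib sum_subtractf)
  qed
  moreover have "(\<Sum>e\<in>B. w e * e) = 1"
    using w[of 1] T(2) by simp
  ultimately show ?thesis
    using that[of B w] B finB by simp
qed

section \<open>Twisted derivations\<close>

lemma nonzero_endomorphism_one:
  assumes "algebra_endomorphism \<tau>" "\<tau> \<noteq> (\<lambda>_. 0)"
  shows "\<tau> 1 = 1"
proof -
  interpret \<tau>: Vector_Spaces.linear scale scale \<tau>
    using assms(1) by (simp add: algebra_endomorphism_def)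
  have mult: "\<tau> (a * b) = \<tau> a * \<tau> b" for a b
    using assms(1) by (simp add: algebra_endomorphism_def)
  have "two_sided_ideal {a. \<tau> a = 0}"
    by (simp add: two_sided_ideal_def mult \<tau>.zero \<tau>.diff)
  then have "{a. \<tau> a = 0} = {0}"
    using simple[of "{a. \<tau> a = 0}"] assms(2) by auto
  then have "inj \<tau>"
    using \<tau>.inj_iff_eq_0 by auto
  obtain B0 where "finite_dimensional_vector_space scale B0"
    using finite_dimensional by blast
  then interpret fd: finite_dimensional_vector_space scale B0 .
  have "surj \<tau>"
    by (rule fd.linear_inj_imp_surj[OF \<tau>.linear_axioms \<open>inj \<tau>\<close>])
  \<comment> \<open>A preimage \<open>a\<close> of \<open>1\<close> suffices:
    \<open>\<tau> 1 = \<tau> 1 * \<tau> a = \<tau> (1 * a) = 1\<close>.\<close>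
  then obtain a where "\<tau> a = 1"
    by (metis surjD)
  then show ?thesis
    using mult[of 1 a] by simp
qed

text \<open>The implementing element \<open>X\<close> is the image of the separability idempotent
  under \<open>a \<otimes> b \<mapsto> \<delta> a * \<tau> b\<close>. Multiplying the idempotent by
  \<open>a\<close> on either side gives the same tensor, and comparing the two images yields the
  formula.\<close>

lemma twisted_derivation_inner:
  assumes \<tau>: "algebra_endomorphism \<tau>" "\<tau> \<noteq> (\<lambda>_. 0)"
    and \<delta>: "twisted_derivation \<sigma> \<tau> \<delta>"
  shows "twisted_inner_derivation \<sigma> \<tau> \<delta>"
proof -
  interpret \<tau>: Vector_Spaces.linear scale scale \<tau>
    using \<tau>(1) by (simp add: algebra_endomorphism_def)
  interpret \<delta>: Vector_Spaces.linear scale scale \<delta>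
    using \<delta> by (simp add: twisted_derivation_def)
  have mult: "\<tau> (a * b) = \<tau> a * \<tau> b" for a b
    using \<tau>(1) by (simp add: algebra_endomorphism_def)
  have deriv: "\<delta> (a * b) = \<delta> a * \<tau> b + \<sigma> a * \<delta> b" for a b
    using \<delta> by (simp add: twisted_derivation_def)
  obtain B w where B: "independent B" "span B = UNIV" "finite B" and one: "(\<Sum>e\<in>B. w e * e) = 1"
    and w: "\<And>x j. j \<in> B \<Longrightarrow> x * w j = (\<Sum>e\<in>B. scale (representation B (e * x) j) (w e))"
    using separability_idempotent by blast
  define X where "X = (\<Sum>e\<in>B. \<delta> (w e) * \<tau> e)"
  have "\<delta> a = X * \<tau> a - \<sigma> a * X" for a
  proof -
    have expand: "(\<Sum>j\<in>B. scale (representation B v j) j) = v" for v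
      by (rule sum_representation_basis[OF B])
    have "X * \<tau> a = (\<Sum>e\<in>B. \<delta> (w e) * \<tau> (\<Sum>j\<in>B. scale (representation B (e * a) j) j))"
      by (simp add: X_def expand mult sum_distrib_right mult.assoc)
    also have "\<dots> = (\<Sum>e\<in>B. \<Sum>j\<in>B. scale (representation B (e * a) j) (\<delta> (w e)) * \<tau> j)"
      by (simp add: \<tau>.sum \<tau>.scale sum_distrib_left flip: scale_mult_left scale_mult_right)
    also have "\<dots> = (\<Sum>j\<in>B. \<Sum>e\<in>B. scale (representation B (e * a) j) (\<delta> (w e)) * \<tau> j)"
      by (rule sum.swap)
    \<comment> \<open>Linearity of \<open>\<delta>\<close> collects the inner sum into
      \<open>\<delta>\<close> of the coordinate formula for \<open>a * w j\<close>. The product rule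
      then splits off \<open>\<sigma> a * X\<close>, and the other part collapses since the
      \<open>w j * j\<close> sum to \<open>1\<close>.\<close>
    also have "\<dots> = (\<Sum>j\<in>B. \<delta> (a * w j) * \<tau> j)"
      by (simp add: w \<delta>.sum \<delta>.scale sum_distrib_right)
    also have "\<dots> = \<delta> a * \<tau> (\<Sum>j\<in>B. w j * j) + \<sigma> a * X"
      by (simp add: deriv X_def \<tau>.sum mult sum.distrib sum_distrib_left distrib_right mult.assoc)
    also have "\<dots> = \<delta> a + \<sigma> a * X"
      by (simp add: one nonzero_endomorphism_one[OF \<tau>])
    finally show ?thesis by simp
  qed
  with \<delta> show ?thesis
    unfolding twisted_inner_derivation_def by blast
qed

end

theorem corollary2p9:
  fixes scale :: "'f::field \<Rightarrow> 'a::ring_1 \<Rightarrow> 'a"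
    and \<sigma> \<tau> \<delta> :: "'a \<Rightarrow> 'a"
  assumes "central_simple_algebra scale"
    and "unital_algebra.algebra_endomorphism scale \<sigma>" and "\<sigma> \<noteq> (\<lambda>_. 0)"
    and "unital_algebra.algebra_endomorphism scale \<tau>" and "\<tau> \<noteq> (\<lambda>_. 0)"
    and "unital_algebra.twisted_derivation scale \<sigma> \<tau> \<delta>"
  shows "unital_algebra.twisted_inner_derivation scale \<sigma> \<tau> \<delta>"
  by (rule central_simple_algebra.twisted_derivation_inner[OF assms(1,4,5,6)])

end
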